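(* Let $n$ and $k$ be fixed integers with $1\le k\le n-1$, and let $a\ge 0$ and $b\ge 0$ be fixed real numbers with $(a,b)\ne(0,0)$. Let $X$ be a real random variable with continuous cumulative distribution function $F$, and let $Q$ be the pseudo-inverse (quantile) function of $F$. Let $X_{k,n}$ and $X_{k+1,n}$ be the $k$-th and $(k+1)$-th order statistics of a sample of size $n$ with parent $X$. Let $\xi_1$ and $\xi_2$ be independent standard exponential random variables which are also independent from $X_{k,n}$ and $X_{k+1,n}$, respectively. Then $$X_{k,n}+a\xi_1\stackrel{d}{=}X_{k+1,n}-b\xi_2$$ holds if and only if there is a constant $c>0$ (which may be arbitrary) such that $$Q(x)=\log\left\{c\,x^{bk}(1-x)^{-a(n-k)}\right\}\qquad\text{for all } 0<x<1.$$
   Context: $\stackrel{d}{=}$ denotes equality in distribution. The order statistics $X_{1,n}\le X_{2,n}\le\dots\le X_{n,n}$ are the increasingly ordered values of $n$ independent copies of $X$. A standard exponential variable has cumulative distribution function $1-e^{-t}$ for $t\ge 0$. The pseudo-inverse (quantile) function of $F$ is $Q(y)=\inf\{x:\ F(x)\ge y\}$ for $y\in(0,1)$. $\log$ is the natural logarithm. *)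

theory Defs
  imports "HOL-Probability.Probability"
begin

text \<open>\<open>order_stat n X j \<omega>\<close> is the \<open>j\<close>-th smallest of \<open>X 0 \<omega>, \<dots>, X (n - 1) \<omega>\<close>, counted with
  multiplicity. The rank \<open>j\<close> runs over \<open>1, \<dots>, n\<close>, whereas list positions start at \<open>0\<close>.\<close>

definition order_stat :: "nat \<Rightarrow> (nat \<Rightarrow> 'w \<Rightarrow> real) \<Rightarrow> nat \<Rightarrow> 'w \<Rightarrow> real" where
  "order_stat n X j \<omega> = sort (map (\<lambda>i. X i \<omega>) [0..<n]) ! (j - 1)"

text \<open>For a cumulative distribution function \<open>F\<close>, the set below is nonempty and bounded below
  when \<open>0 < y < 1\<close>; \<open>quantile F y\<close> carries no meaning for other \<open>y\<close>.\<close>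

definition quantile :: "(real \<Rightarrow> real) \<Rightarrow> real \<Rightarrow> real" where
  "quantile F y = Inf {x. F x \<ge> y}"

end

theory Submission
  imports Defs "HOL-Real_Asymp.Real_Asymp"
begin

text \<open>
Let \<open>G\<^sub>j\<close> be the cdf of the \<open>j\<close>-th order statistic, a polynomial in \<open>F\<close>. If \<open>Y\<close> has the continuous
cdf \<open>G\<close>, then the cdf \<open>W\<close> of \<open>Y + s \<xi>\<close> is the bounded solution of \<open>W + s W' = G\<close>. Hence the two sides
have a common cdf \<open>H\<close> iff \<open>H + a H' = G\<^sub>k\<close> and \<open>H - b H' = G\<^bsub>k+1\<^esub>\<close>, i.e.
\<open>(a + b) H = b G\<^sub>k + a G\<^bsub>k+1\<^esub>\<close> and \<open>(a + b) H' = G\<^sub>k - G\<^bsub>k+1\<^esub>\<close>. The first equation makes \<open>H\<close> a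
polynomial in \<open>F\<close> with nonzero derivative on \<open>(0, 1)\<close>, so \<open>F\<close> is differentiable where
\<open>0 < F < 1\<close>, and the second becomes \<open>F' (b k / F + a (n - k) / (1 - F)) = 1\<close>. This
integrates to \<open>b k ln F(x) - a (n - k) ln (1 - F(x)) = x - c\<close>, whose inverse is the quantile function.
\<close>

section \<open>Order statistics and the binomial form of their cdf\<close>

text \<open>The entries at most \<open>x\<close> fill an initial segment of a sorted list, so
  position \<open>j - 1\<close> lies in it exactly when that segment has length at least
  \<open>j\<close>.\<close>

lemma sorted_nth_le_iff:
  assumes "sorted ys" "1 \<le> j" "j \<le> length ys"
  shows "ys ! (j - 1) \<le> (x :: 'a :: linorder) \<longleftrightarrow> j \<le> length (filter (\<lambda>y. y \<le> x) ys)"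
proof -
  let ?S = "{i. i < length ys \<and> ys ! i \<le> x}"
  have "ys ! (j - 1) \<le> x \<longleftrightarrow> j \<le> card ?S"
  proof
    assume "ys ! (j - 1) \<le> x"
    moreover have "ys ! i \<le> ys ! (j - 1)" if "i < j" for i
      using that assms by (intro sorted_nth_mono) auto
    ultimately have "{..<j} \<subseteq> ?S"
      using assms by (auto intro: order_trans less_le_trans)
    moreover have "finite ?S" by simp
    ultimately show "j \<le> card ?S"
      using card_mono[of ?S "{..<j}"] by simp
  next
    assume le: "j \<le> card ?S"
    show "ys ! (j - 1) \<le> x"
    proof (rule ccontr)
      assume neg: "\<not> ?thesis"
      have "i < j - 1" if "i < length ys" "ys ! i \<le> x" for i
        using sorted_nth_mono[OF assms(1), of "j - 1" i] that neg
        by (meson not_less order_trans)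
      then have "?S \<subseteq> {..<j - 1}" by auto
      then have "card ?S \<le> j - 1"
        using card_mono[of "{..<j - 1}" ?S] by simp
      with le assms(2) show False by simp
    qed
  qed
  then show ?thesis by (simp add: length_filter_conv_card)
qed

text \<open>Sorting preserves the number of entries at most \<open>x\<close>. The event becomes a
  count over the unsorted variables, to which independence applies.\<close>

lemma order_stat_le_iff:
  assumes "1 \<le> j" "j \<le> n"
  shows "order_stat n X j \<omega> \<le> x \<longleftrightarrow> j \<le> card {i \<in> {..<n}. X i \<omega> \<le> x}"
proof -
  let ?xs = "map (\<lambda>i. X i \<omega>) [0..<n]"
  have "order_stat n X j \<omega> \<le> x \<longleftrightarrow> j \<le> length (filter (\<lambda>y. y \<le> x) (sort ?xs))"
    unfolding order_stat_def using assms by (intro sorted_nth_le_iff) auto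
  also have "length (filter (\<lambda>y. y \<le> x) (sort ?xs)) = length (filter (\<lambda>y. y \<le> x) ?xs)"
    by (metis filter_sort length_sort)
  also have "\<dots> = card {i \<in> {..<n}. X i \<omega> \<le> x}"
    by (simp add: length_filter_conv_card) (rule arg_cong[where f = card], auto)
  finally show ?thesis .
qed

text \<open>For \<open>1 \<le> j\<close> and \<open>j \<le> n\<close> this is the regularised
  incomplete beta function with parameters \<open>j\<close> and \<open>n - j + 1\<close>: on [0, 1],
  the cdf of the \<open>j\<close>-th order statistic of \<open>n\<close> independent uniform
  variables.\<close>

definition binomial_tail :: "nat \<Rightarrow> nat \<Rightarrow> real \<Rightarrow> real" where
  "binomial_tail n j u = (\<Sum>m = j..n. real (n choose m) * u ^ m * (1 - u) ^ (n - m))"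

lemma binomial_tail_Suc:
  "j \<le> n \<Longrightarrow> binomial_tail n j u
     = real (n choose j) * u ^ j * (1 - u) ^ (n - j) + binomial_tail n (Suc j) u"
  unfolding binomial_tail_def by (simp add: sum.atLeast_Suc_atMost)

text \<open>Downward induction from \<open>j = n\<close> telescopes: the negative half of the
  product rule for the summand of index \<open>j\<close> cancels the derivative of the tail starting
  at \<open>Suc j\<close>. What remains is a beta density.\<close>

lemma DERIV_binomial_tail:
  assumes "1 \<le> j" "j \<le> n"
  shows "(binomial_tail n j has_real_derivative
            real j * real (n choose j) * u ^ (j - 1) * (1 - u) ^ (n - j)) (at u)"
  using assms(2,1)
proof (induction rule: inc_induct)
  case base
  then show ?case
    unfolding binomial_tail_def by (auto intro!: derivative_eq_intros)
next
  case (step j)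
  have eq: "binomial_tail n j
      = (\<lambda>u. real (n choose j) * u ^ j * (1 - u) ^ (n - j) + binomial_tail n (Suc j) u)"
    using binomial_tail_Suc step.hyps by (intro ext) simp
  have IH: "(binomial_tail n (Suc j) has_real_derivative
      real (Suc j) * real (n choose Suc j) * u ^ j * (1 - u) ^ (n - Suc j)) (at u)"
    using step.IH by simp
  have "Suc j * (n choose Suc j) = (n - j) * (n choose j)"
    using binomial_absorb_comp[of n j] binomial_absorption[of j n]
    by (metis binomial_absorption binomial_absorb_comp)
  then have coeff: "real (Suc j) * real (n choose Suc j) = real (n - j) * real (n choose j)"
    by (metis of_nat_mult)
  show ?case
    unfolding eq
    by (rule derivative_eq_intros refl IH)+ (use coeff in \<open>simp add: algebra_simps\<close>)
qed

lemma continuous_on_binomial_tail: "continuous_on A (binomial_tail n j)"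
  unfolding binomial_tail_def by (intro continuous_intros)

text \<open>The event splits into disjoint pieces according to the exact set \<open>S\<close> of
  indices whose variable is at most \<open>x\<close>. By independence a piece depends only on the
  size \<open>m\<close> of \<open>S\<close>, and there are \<open>n choose m\<close> sets of that
  size.\<close>

lemma (in prob_space) cdf_order_stat:
  assumes indep: "indep_vars (\<lambda>_. borel) X {..<n}"
    and cdf_X: "\<And>i. i < n \<Longrightarrow> prob {\<omega> \<in> space M. X i \<omega> \<le> x} = p"
    and j: "1 \<le> j" "j \<le> n"
  shows "prob {\<omega> \<in> space M. order_stat n X j \<omega> \<le> x} = binomial_tail n j p"
proof -
  define A where "A S i = (if i \<in> S then {..x} else {x<..})" for S :: "nat set" and i
  define E where "E S = (\<Inter>i\<in>{..<n}. X i -` A S i \<inter> space M)" for S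
  define \<S> where "\<S> m = {S. S \<subseteq> {..<n} \<and> card S = m}" for m
  \<comment> \<open>Over an empty index set the intersection defining \<open>E S\<close> would be
    \<open>UNIV\<close> instead of \<open>space M\<close>.\<close>
  have n: "{..<n} \<noteq> {}" using j by (simp add: lessThan_empty_iff)
  have fin: "finite (\<S> m)" for m
    unfolding \<S>_def by simp
  have rv[measurable]: "X i \<in> borel_measurable M" if "i < n" for i
    using indep that by (auto simp: indep_vars_def)
  have A_borel [measurable]: "A S i \<in> sets borel" for S i by (simp add: A_def)
  have E_event: "E S \<in> events" for S
    unfolding E_def using n by (intro sets.finite_INT) auto
  have E_eq: "E S = {\<omega> \<in> space M. {i \<in> {..<n}. X i \<omega> \<le> x} = S}" if "S \<subseteq> {..<n}" for S
    using that n unfolding E_def A_def by (auto split: if_splits simp: not_le)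
  have gt: "prob (X i -` {x<..} \<inter> space M) = 1 - p" if "i < n" for i
  proof -
    have "X i -` {x<..} \<inter> space M = space M - {\<omega> \<in> space M. X i \<omega> \<le> x}" by auto
    moreover have "{\<omega> \<in> space M. X i \<omega> \<le> x} \<in> events" using that by measurable
    ultimately show ?thesis using cdf_X[OF that] by (simp add: prob_compl)
  qed
  have le: "prob (X i -` {..x} \<inter> space M) = p" if "i < n" for i
    using cdf_X[OF that] by (auto simp: vimage_def Int_def conj_commute)
  have prob_E: "prob (E S) = p ^ m * (1 - p) ^ (n - m)" if "S \<in> \<S> m" for S m
  proof -
    have S: "S \<subseteq> {..<n}" "card S = m" using that by (auto simp: \<S>_def)
    then have finS: "finite S" using finite_subset by blast
    have "prob (E S) = (\<Prod>i<n. prob (X i -` A S i \<inter> space M))"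
      unfolding E_def using n by (intro indep_varsD[OF indep]) auto
    also have "\<dots> = (\<Prod>i<n. if i \<in> S then p else 1 - p)"
      by (intro prod.cong) (auto simp: A_def le gt)
    also have "\<dots> = p ^ card ({..<n} \<inter> S) * (1 - p) ^ card ({..<n} - S)"
      by (simp add: prod.If_cases Diff_eq)
    also have "{..<n} \<inter> S = S" using S by auto
    also have "card ({..<n} - S) = n - m" using S finS by (simp add: card_Diff_subset)
    finally show ?thesis using S by simp
  qed
  have "{\<omega> \<in> space M. order_stat n X j \<omega> \<le> x} = (\<Union>S\<in>(\<Union>m\<in>{j..n}. \<S> m). E S)"
  proof (intro set_eqI iffI)
    fix \<omega> assume "\<omega> \<in> {\<omega> \<in> space M. order_stat n X j \<omega> \<le> x}"
    moreover define S where "S = {i \<in> {..<n}. X i \<omega> \<le> x}"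
    moreover have "card S \<le> n"
      using card_mono[of "{..<n}" S] by (auto simp: S_def)
    moreover have "S \<subseteq> {..<n}" by (auto simp: S_def)
    ultimately have "S \<in> (\<Union>m\<in>{j..n}. \<S> m)" "\<omega> \<in> E S"
      using j by (auto simp: order_stat_le_iff \<S>_def E_eq)
    then show "\<omega> \<in> (\<Union>S\<in>(\<Union>m\<in>{j..n}. \<S> m). E S)" by blast
  qed (use j in \<open>auto simp: order_stat_le_iff \<S>_def E_eq\<close>)
  also have "prob \<dots> = (\<Sum>S\<in>(\<Union>m\<in>{j..n}. \<S> m). prob (E S))"
  proof (rule finite_measure_finite_Union)
    show "disjoint_family_on E (\<Union>m\<in>{j..n}. \<S> m)"
      by (auto simp: disjoint_family_on_def E_eq \<S>_def)
  qed (use fin E_event in auto)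
  also have "\<dots> = (\<Sum>m = j..n. \<Sum>S\<in>\<S> m. prob (E S))"
    using fin by (intro sum.UNION_disjoint) (auto simp: \<S>_def)
  also have "\<dots> = (\<Sum>m = j..n. \<Sum>S\<in>\<S> m. p ^ m * (1 - p) ^ (n - m))"
    by (intro sum.cong) (auto simp: prob_E)
  also have "\<dots> = binomial_tail n j p"
    by (simp add: binomial_tail_def \<S>_def n_subsets mult.assoc)
  finally show ?thesis .
qed

section \<open>Exponential mixtures and their differential equation\<close>

text \<open>The cdf of \<open>Y + s \<xi>\<close>, where \<open>Y\<close> has cdf \<open>G\<close> and \<open>\<xi>\<close> is standard exponential; \<open>s\<close> may be negative.\<close>

definition exp_mixture :: "real \<Rightarrow> (real \<Rightarrow> real) \<Rightarrow> real \<Rightarrow> real" where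
  "exp_mixture s G x = (LINT t|lborel. exponential_density 1 t * G (x - s * t))"

lemma integrable_exponential_density: "integrable lborel (exponential_density 1)"
  and integral_exponential_density: "integral\<^sup>L lborel (exponential_density 1) = 1"
proof -
  interpret prob_space "density lborel (exponential_density 1)"
    by (rule prob_space_exponential_density) simp
  have nn: "AE x in lborel. 0 \<le> exponential_density 1 x"
    by (simp add: exponential_density_nonneg)
  have "(\<integral>\<^sup>+ x. ennreal (exponential_density 1 x) \<partial>lborel) = 1"
    using emeasure_space_1 by (simp add: emeasure_density)
  then have "has_bochner_integral lborel (exponential_density 1) 1"
    by (intro has_bochner_integral_nn_integral nn) auto
  then show "integrable lborel (exponential_density 1)"
    and "integral\<^sup>L lborel (exponential_density 1) = 1"
    by (auto simp: has_bochner_integral_iff)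
qed

lemma integrable_exp_mixture:
  assumes "continuous_on UNIV G" "\<And>y. \<bar>G y\<bar> \<le> B"
  shows "integrable lborel (\<lambda>t. exponential_density 1 t * G (x - s * t))"
proof -
  have [measurable]: "G \<in> borel_measurable borel"
    by (rule borel_measurable_continuous_onI) fact
  have "norm (exponential_density 1 t * G (x - s * t)) \<le> norm (B * exponential_density 1 t)" for t
  proof -
    have "\<bar>G (x - s * t)\<bar> \<le> \<bar>B\<bar>" using assms(2)[of "x - s * t"] by linarith
    then show ?thesis by (simp add: abs_mult mult.commute[of B] mult_left_mono)
  qed
  then show ?thesis
    by (intro Bochner_Integration.integrable_bound
         [OF integrable_mult_right[OF integrable_exponential_density, of B]] always_eventually allI)
      measurable
qed

lemma abs_exp_mixture_le:
  assumes "continuous_on UNIV G" "\<And>y. \<bar>G y\<bar> \<le> B"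
  shows "\<bar>exp_mixture s G x\<bar> \<le> B"
proof -
  have "\<bar>exp_mixture s G x\<bar> \<le> (LINT t|lborel. B * exponential_density 1 t)"
    unfolding exp_mixture_def
  proof (rule order_trans[OF integral_abs_bound integral_mono])
    show "\<bar>exponential_density 1 t * G (x - s * t)\<bar> \<le> B * exponential_density 1 t" for t
      using assms(2)[of "x - s * t"] exponential_density_nonneg[of 1 t]
      by (auto simp: abs_mult mult.commute[of B] intro!: mult_left_mono)
  qed (use integrable_exp_mixture[OF assms] integrable_exponential_density in auto)
  then show ?thesis by (simp add: integral_exponential_density)
qed

lemma exp_mixture_0: "exp_mixture 0 G x = G x"
  unfolding exp_mixture_def mult_zero_left diff_zero integral_mult_left_zero
    integral_exponential_density mult_1_left ..

text \<open>The substitution \<open>y = x - s * t\<close> moves \<open>x\<close> out of the argument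
  of \<open>G\<close> and into the limit of integration. The mixture can then be differentiated
  although \<open>G\<close> is merely continuous.\<close>

lemma exp_mixture_eq_set_integral:
  assumes "0 < s"
  shows "exp_mixture s G x = exp (- x / s) * (LINT y:{..x}|lborel. G y * exp (y / s) / s)"
proof -
  have "exp_mixture s G x
      = (1 / s) * (LINT y|lborel. exponential_density 1 (x / s - y / s) * G y)"
  proof -
    have "x - s * (x / s - y / s) = y" for y
      using assms by (simp add: right_diff_distrib')
    then show ?thesis
      unfolding exp_mixture_def using assms
      by (subst lborel_integral_real_affine[where c = "- 1 / s" and t = "x / s"]) simp_all
  qed
  also have "\<dots> = (1 / s) * (LINT y|lborel. exp (- x / s) * s * (indicator {..x} y * (G y * exp (y / s) / s)))"
  proof (intro arg_cong[where f = "\<lambda>z. 1 / s * z"] Bochner_Integration.integral_cong refl)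
    fix y
    have "x / s - y / s < 0 \<longleftrightarrow> \<not> y \<le> x"
      using assms by (simp add: divide_less_cancel not_le)
    moreover have "exp (- (x / s - y / s)) = exp (- x / s) * exp (y / s)"
      by (simp flip: exp_add)
    ultimately show "exponential_density 1 (x / s - y / s) * G y
        = exp (- x / s) * s * (indicator {..x} y * (G y * exp (y / s) / s))"
      using assms by (auto simp: exponential_density_def)
  qed
  also have "\<dots> = exp (- x / s) * (LINT y:{..x}|lborel. G y * exp (y / s) / s)"
    using assms by (simp add: set_lebesgue_integral_def)
  finally show ?thesis .
qed

lemma set_integrable_exp_mixture:
  fixes x s :: real
  assumes G: "continuous_on UNIV G" "\<And>y. \<bar>G y\<bar> \<le> B" and s: "0 < s"
  shows "set_integrable lborel {..x} (\<lambda>y. G y * exp (y / s) / s)"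
proof -
  have "integrable lborel (\<lambda>t. exponential_density 1 (x / s + (- 1 / s) * t) * G (x - s * (x / s + (- 1 / s) * t)))"
    using s by (intro lborel_integrable_real_affine integrable_exp_mixture[OF G]) auto
  then have "integrable lborel (\<lambda>t. exp (x / s) / s * (exponential_density 1 (x / s + (- 1 / s) * t) * G (x - s * (x / s + (- 1 / s) * t))))"
    by (rule integrable_mult_right)
  moreover have "exp (x / s) / s * (exponential_density 1 (x / s + (- 1 / s) * y) * G (x - s * (x / s + (- 1 / s) * y)))
     = indicator {..x} y *\<^sub>R (G y * exp (y / s) / s)" for y
  proof -
    have "x / s - y / s < 0 \<longleftrightarrow> \<not> y \<le> x"
      using s by (simp add: divide_less_cancel not_le)
    moreover have "exp (x / s) * exp (- (x / s - y / s)) = exp (y / s)"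
      by (simp flip: exp_add)
    moreover have "x / s + (- 1 / s) * y = x / s - y / s" "x - s * (x / s - y / s) = y"
      using s by (simp_all add: right_diff_distrib')
    ultimately show ?thesis
      using s by (auto simp: exponential_density_def)
  qed
  ultimately show ?thesis unfolding set_integrable_def by (simp only:)
qed

text \<open>Product rule and fundamental theorem of calculus, applied to
  \<open>exp (- x / s)\<close> times an integral up to \<open>x\<close>.\<close>

lemma DERIV_exp_mixture_pos:
  assumes G: "continuous_on UNIV G" "\<And>y. \<bar>G y\<bar> \<le> B" and s: "0 < s"
  shows "(exp_mixture s G has_real_derivative (G x - exp_mixture s G x) / s) (at x)"
proof -
  define g where "g y = G y * exp (y / s) / s" for y
  define I where "I = (LINT y:{..x - 1}|lborel. g y)"
  have cont: "continuous_on A g" for A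
    unfolding g_def using s
    by (intro continuous_intros continuous_on_subset[OF G(1)]) auto
  have int: "set_integrable lborel {..z} g" for z
    unfolding g_def by (rule set_integrable_exp_mixture[OF assms])
  \<comment> \<open>Only the integral over the compact interval varies with \<open>z\<close>; the
    half-line below \<open>x - 1\<close> contributes the constant \<open>I\<close>. The base point
    \<open>x - 1\<close> leaves room for \<open>z\<close> on both sides of \<open>x\<close>.\<close>
  have split: "(LINT y:{..z}|lborel. g y) = I + integral {x - 1..z} g" if "x - 1 < z" for z
  proof -
    have "{..z} = {..x - 1} \<union> {x - 1<..z}" using that by auto
    moreover have ioc: "set_integrable lborel {x - 1<..z} g"
      by (rule set_integrable_subset[OF int[of z]]) auto
    ultimately have "(LINT y:{..z}|lborel. g y) = I + (LINT y:{x - 1<..z}|lborel. g y)"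
      unfolding I_def using int by (simp add: set_integral_Un ivl_disj_int)
    also have "(LINT y:{x - 1<..z}|lborel. g y) = (LINT y:{x - 1..z}|lborel. g y)"
    proof -
      have "AE y in lborel. y \<noteq> x - 1" by (rule AE_lborel_singleton)
      then show ?thesis
        unfolding set_lebesgue_integral_def
        using borel_measurable_continuous_onI[OF cont]
        by (intro integral_cong_AE) (auto elim!: eventually_mono split: split_indicator)
    qed
    also have "\<dots> = integral {x - 1..z} g"
      by (intro set_borel_integral_eq_integral borel_integrable_atLeastAtMost' cont)
    finally show ?thesis .
  qed
  have "((\<lambda>z. integral {x - 1..z} g) has_real_derivative g x) (at x within {x - 1..x + 1})"
    by (intro integral_has_real_derivative cont) auto
  then have dI: "((\<lambda>z. integral {x - 1..z} g) has_real_derivative g x) (at x)"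
    by (simp add: at_within_Icc_at)
  have "((\<lambda>z. exp (- z / s) * (I + integral {x - 1..z} g)) has_real_derivative
      (- 1 / s) * exp (- x / s) * (I + integral {x - 1..x} g) + exp (- x / s) * g x) (at x)"
    by (rule derivative_eq_intros dI refl | use s in simp)+
  moreover have "(- 1 / s) * exp (- x / s) * (I + integral {x - 1..x} g) + exp (- x / s) * g x
      = (G x - exp_mixture s G x) / s"
  proof -
    have "exp_mixture s G x = exp (- x / s) * (I + integral {x - 1..x} g)"
      using split[of x] exp_mixture_eq_set_integral[OF s, of G x] by (simp add: g_def)
    moreover have "exp (- x / s) * g x = G x / s"
      by (simp add: g_def flip: exp_add)
    ultimately show ?thesis by (simp add: diff_divide_distrib)
  qed
  ultimately have "((\<lambda>z. exp (- z / s) * (I + integral {x - 1..z} g)) has_real_derivative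
      (G x - exp_mixture s G x) / s) (at x)" by simp
  then show ?thesis
  proof (rule has_field_derivative_transform_within_open[of _ _ _ "{x - 1<..}"])
    show "exp (- z / s) * (I + integral {x - 1..z} g) = exp_mixture s G z" if "z \<in> {x - 1<..}" for z
      using exp_mixture_eq_set_integral[OF s, of G z, folded g_def] split[of z] that by simp
  qed auto
qed

text \<open>Reflecting the line turns a negative \<open>s\<close> into the positive
  \<open>- s\<close>, so one differential equation serves for adding and for subtracting an
  exponential variable.\<close>

lemma DERIV_exp_mixture:
  assumes G: "continuous_on UNIV G" "\<And>y. \<bar>G y\<bar> \<le> B" and s: "s \<noteq> 0"
  shows "(exp_mixture s G has_real_derivative (G x - exp_mixture s G x) / s) (at x)"
proof (cases "0 < s")
  case True
  then show ?thesis using DERIV_exp_mixture_pos G by blast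
next
  case False
  define G' where "G' y = G (- y)" for y
  have refl: "exp_mixture s G = (\<lambda>x. exp_mixture (- s) G' (- x))"
    by (simp add: exp_mixture_def G'_def fun_eq_iff)
  have "continuous_on UNIV G'"
    unfolding G'_def by (rule continuous_on_compose2[OF G(1)]) (auto intro: continuous_on_minus continuous_on_id)
  then have "(exp_mixture (- s) G' has_real_derivative
      (G' (- x) - exp_mixture (- s) G' (- x)) / (- s)) (at (- x))"
    using False s G by (intro DERIV_exp_mixture_pos[where B = B]) (auto simp: G'_def)
  from DERIV_chain2[where g = uminus and x = x and Db = "- 1" and s = UNIV, OF this]
  have "((\<lambda>x. exp_mixture (- s) G' (- x)) has_real_derivative
      (G' (- x) - exp_mixture (- s) G' (- x)) / s) (at x)"
    using DERIV_minus[OF DERIV_ident] by auto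
  then show ?thesis unfolding refl by (simp add: G'_def)
qed

text \<open>Two solutions of \<open>W + s W' = G\<close> differ by a multiple of
  \<open>exp (- x / s)\<close>, which is unbounded on the line unless it vanishes. A finite
  exceptional set \<open>K\<close> is harmless because a continuous function with zero derivative
  off \<open>K\<close> is still constant; it will absorb possible kinks of a cdf.\<close>

lemma exp_mixture_unique:
  assumes G: "continuous_on UNIV G" "\<And>y. \<bar>G y\<bar> \<le> B"
    and H: "continuous_on UNIV H" "\<And>y. \<bar>H y\<bar> \<le> C"
    and s: "s \<noteq> 0" and K: "finite K"
    and deriv: "\<And>x. x \<notin> K \<Longrightarrow> (H has_real_derivative (G x - H x) / s) (at x)"
  shows "exp_mixture s G = H"
proof
  fix x
  let ?W = "exp_mixture s G"
  define D where "D y = exp (y / s) * (H y - ?W y)" for y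
  have dW: "(?W has_real_derivative (G y - ?W y) / s) (at y)" for y
    by (rule DERIV_exp_mixture[OF G s])
  then have "continuous_on UNIV ?W"
    by (meson DERIV_isCont continuous_at_imp_continuous_on)
  then have cont: "continuous_on UNIV D"
    unfolding D_def using s by (intro continuous_intros H) auto
  have "(D has_real_derivative 0) (at y)" if "y \<notin> K" for y
    unfolding D_def
    by (rule derivative_eq_intros refl dW deriv that s | use s in \<open>simp add: field_simps\<close>)+
  then obtain c where c: "D y = c" for y
    using DERIV_zero_connected_constant[of UNIV K D] K cont by auto
  have bound: "\<bar>c\<bar> \<le> exp (- real m) * (B + C)" for m
  proof -
    \<comment> \<open>Along these points \<open>exp (?y / s)\<close> is
      \<open>exp (- real m)\<close> for either sign of \<open>s\<close>.\<close>
    let ?y = "- s * real m"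
    have "\<bar>H ?y - ?W ?y\<bar> \<le> B + C"
      using H(2)[of ?y] abs_exp_mixture_le[OF G, of s ?y] by linarith
    then show ?thesis
      using c[of ?y] s by (auto simp: D_def abs_mult)
  qed
  have "(\<lambda>m. exp (- real m) * (B + C)) \<longlonglongrightarrow> 0"
    by real_asymp
  then have "\<bar>c\<bar> \<le> 0"
    using bound by (intro LIMSEQ_le_const) auto
  then show "?W x = H x" using c[of x] by (simp add: D_def)
qed

text \<open>Independence makes the joint law a product measure. The section at
  \<open>\<xi> = t\<close> of the event is \<open>Y \<le> x - s * t\<close>, so Fubini yields the
  mixture integral.\<close>

lemma (in prob_space) cdf_add_exponential:
  assumes indep: "indep_var borel \<xi> borel Y"
    and \<xi>: "distributed M lborel \<xi> (exponential_density 1)"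
    and cont: "continuous_on UNIV (\<lambda>x. prob {\<omega> \<in> space M. Y \<omega> \<le> x})"
  shows "cdf (distr M borel (\<lambda>\<omega>. Y \<omega> + s * \<xi> \<omega>)) x
           = exp_mixture s (\<lambda>x. prob {\<omega> \<in> space M. Y \<omega> \<le> x}) x"
proof -
  let ?G = "\<lambda>x. prob {\<omega> \<in> space M. Y \<omega> \<le> x}"
  have rv [measurable]: "\<xi> \<in> borel_measurable M" "Y \<in> borel_measurable M"
    and prod: "distr M borel \<xi> \<Otimes>\<^sub>M distr M borel Y
                 = distr M (borel \<Otimes>\<^sub>M borel) (\<lambda>\<omega>. (\<xi> \<omega>, Y \<omega>))"
    using indep by (auto simp: indep_var_distribution_eq)
  have [measurable]: "?G \<in> borel_measurable borel"
    by (rule borel_measurable_continuous_onI[OF cont])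
  interpret Y: prob_space "distr M borel Y" by (rule prob_space_distr) simp
  have dist: "distr M borel \<xi> = density lborel (exponential_density 1)"
    using \<xi> unfolding distributed_def by (metis distr_cong sets_lborel)
  define A where "A = {z :: real \<times> real. snd z + s * fst z \<le> x}"
  have A [measurable]: "A \<in> sets (borel \<Otimes>\<^sub>M borel)"
  proof -
    have "A \<in> sets borel"
      unfolding A_def by (intro borel_closed closed_Collect_le continuous_intros)
    then show ?thesis by (simp only: borel_prod)
  qed
  have "emeasure (distr M borel (\<lambda>\<omega>. Y \<omega> + s * \<xi> \<omega>)) {..x}
      = emeasure M ((\<lambda>\<omega>. (\<xi> \<omega>, Y \<omega>)) -` A \<inter> space M)"
    by (subst emeasure_distr) (auto simp: A_def intro!: arg_cong[where f = "emeasure M"])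
  also have "\<dots> = emeasure (distr M borel \<xi> \<Otimes>\<^sub>M distr M borel Y) A"
    unfolding prod by (rule emeasure_distr[symmetric]) (use A in measurable)
  also have "\<dots> = (\<integral>\<^sup>+ t. emeasure (distr M borel Y) (Pair t -` A) \<partial>distr M borel \<xi>)"
    by (rule Y.emeasure_pair_measure_alt) (use A in simp)
  also have "\<dots> = (\<integral>\<^sup>+ t. ennreal (?G (x - s * t)) \<partial>distr M borel \<xi>)"
  proof (rule nn_integral_cong)
    fix t
    have "Pair t -` A = {..x - s * t}" by (auto simp: A_def)
    then have "emeasure (distr M borel Y) (Pair t -` A) = emeasure M (Y -` {..x - s * t} \<inter> space M)"
      by (simp add: emeasure_distr)
    also have "Y -` {..x - s * t} \<inter> space M = {\<omega> \<in> space M. Y \<omega> \<le> x - s * t}" by auto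
    finally show "emeasure (distr M borel Y) (Pair t -` A) = ennreal (?G (x - s * t))"
      by (simp add: emeasure_eq_measure)
  qed
  also have "\<dots> = (\<integral>\<^sup>+ t. ennreal (exponential_density 1 t * ?G (x - s * t)) \<partial>lborel)"
    unfolding dist
    by (subst nn_integral_density) (simp_all add: exponential_density_nonneg ennreal_mult)
  also have "\<dots> = ennreal (exp_mixture s ?G x)"
    unfolding exp_mixture_def
    by (intro nn_integral_eq_integral integrable_exp_mixture[OF cont, of 1] always_eventually allI)
      (simp_all add: exponential_density_nonneg)
  finally have "emeasure (distr M borel (\<lambda>\<omega>. Y \<omega> + s * \<xi> \<omega>)) {..x} = ennreal (exp_mixture s ?G x)" .
  moreover have "0 \<le> exp_mixture s ?G x"
    unfolding exp_mixture_def
    by (intro integral_nonneg_AE always_eventually allI) (simp add: exponential_density_nonneg)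
  ultimately show ?thesis by (simp add: cdf_def measure_def)
qed

section \<open>Differentiating an inner function, and weighted log odds\<close>

text \<open>By Caratheodory's factorisation of difference quotients \<open>f\<close> need not be invertible.\<close>

lemma DERIV_cancel_outer:
  fixes f g :: "real \<Rightarrow> real"
  assumes f: "(f has_real_derivative d) (at (g x))" "d \<noteq> 0"
    and fg: "((\<lambda>z. f (g z)) has_real_derivative h) (at x)"
    and g: "isCont g x"
  shows "(g has_real_derivative h / d) (at x)"
proof -
  obtain \<phi> where \<phi>: "f u - f (g x) = \<phi> u * (u - g x)" "isCont \<phi> (g x)" "\<phi> (g x) = d" for u
    using f(1) unfolding CARAT_DERIV by blast
  obtain \<psi> where \<psi>: "f (g z) - f (g x) = \<psi> z * (z - x)" "isCont \<psi> x" "\<psi> x = h" for z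
    using fg unfolding CARAT_DERIV by blast
  have cont: "isCont (\<lambda>z. \<phi> (g z)) x"
    using g \<phi>(2) by (rule isCont_o2)
  then have "((\<lambda>z. \<phi> (g z)) \<longlongrightarrow> \<phi> (g x)) (nhds x)"
    unfolding isCont_def by (rule tendsto_at_iff_tendsto_nhds[THEN iffD1])
  then have "\<forall>\<^sub>F z in nhds x. \<phi> (g z) \<noteq> 0"
    using f(2) \<phi>(3) by (intro tendsto_imp_eventually_ne[where c = d]) auto
  then have ev: "\<forall>\<^sub>F z in nhds x. \<psi> z / \<phi> (g z) * (z - x) + g x = g z"
  proof (rule eventually_mono)
    fix z assume "\<phi> (g z) \<noteq> 0"
    then show "\<psi> z / \<phi> (g z) * (z - x) + g x = g z"
      using \<phi>(1)[of "g z"] \<psi>(1)[of z] by (simp add: field_simps)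
  qed
  \<comment> \<open>Dividing the two factorisations gives one for \<open>g\<close>: the quotient is
    continuous at \<open>x\<close>, with value \<open>h / d\<close>, since \<open>d\<close> is
    nonzero. It represents \<open>g\<close> only near \<open>x\<close>, where the denominator stays
    away from zero.\<close>
  have "((\<lambda>z. \<psi> z / \<phi> (g z) * (z - x) + g x) has_real_derivative h / d) (at x)"
    unfolding CARAT_DERIV
    using cont \<psi>(2,3) \<phi>(3) f(2)
    by (intro exI[of _ "\<lambda>z. \<psi> z / \<phi> (g z)"]) (auto intro!: continuous_intros)
  then show ?thesis
    using DERIV_cong_ev[OF refl ev refl] by blast
qed

text \<open>A weighted logit. With the weights of the theorem it is the claimed quantile function up
  to the additive constant \<open>ln c\<close>.\<close>

definition log_odds :: "real \<Rightarrow> real \<Rightarrow> real \<Rightarrow> real" where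
  "log_odds \<alpha> \<beta> u = \<beta> * ln u - \<alpha> * ln (1 - u)"

lemma DERIV_log_odds:
  assumes "0 < u" "u < 1"
  shows "(log_odds \<alpha> \<beta> has_real_derivative \<beta> / u + \<alpha> / (1 - u)) (at u)"
  unfolding log_odds_def using assms
  by (auto intro!: derivative_eq_intros)

section \<open>Continuous cdfs and their quantile functions\<close>

text \<open>\<open>attains\<close> is the form in which the limits of a cdf at infinity enter, via
  the intermediate value theorem. Flat pieces of \<open>F\<close> are allowed.\<close>

locale continuous_cdf =
  fixes F :: "real \<Rightarrow> real"
  assumes cont: "continuous_on UNIV F" and mono: "mono F"
    and range: "0 \<le> F x" "F x \<le> 1"
    and attains: "0 < y \<Longrightarrow> y < 1 \<Longrightarrow> \<exists>x. F x = y"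
begin

lemma isCont_F: "isCont F x"
  using cont by (simp add: continuous_on_eq_continuous_at)

lemma le_if_less: "F x < F z \<Longrightarrow> x \<le> z"
  using mono by (meson linorder_not_le monoD nle_le order_less_imp_le)

lemma bdd_below_superlevel:
  assumes "0 < y"
  shows "bdd_below {x. y \<le> F x}"
proof -
  \<comment> \<open>This value lies strictly between 0 and 1, hence is attained, and lies below
    \<open>y\<close>; so the superlevel set is to the right of \<open>z\<close>.\<close>
  obtain z where z: "F z = min y 1 / 2"
    using attains[of "min y 1 / 2"] assms by fastforce
  show ?thesis
    by (rule bdd_belowI[of _ z]) (use z assms in \<open>auto intro!: le_if_less\<close>)
qed

text \<open>A left inverse makes \<open>F\<close> injective where it is strictly between 0 and 1.
  The only point at level \<open>y\<close> is then the least element of the superlevel set.\<close>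

lemma quantile_eq_of_left_inverse:
  assumes T: "\<And>x. 0 < F x \<Longrightarrow> F x < 1 \<Longrightarrow> T (F x) = x - c"
    and y: "0 < y" "y < 1"
  shows "quantile F y = T y + c"
proof -
  obtain x where x: "F x = y" using attains y by blast
  have "x \<le> z" if "y \<le> F z" for z
  proof (rule ccontr)
    assume "\<not> x \<le> z"
    then have "F z = y"
      using mono that x by (metis linorder_not_le monoD nle_le order_less_imp_le)
    then show False using T[of z] T[of x] x y \<open>\<not> x \<le> z\<close> by simp
  qed
  then have "quantile F y = x"
    unfolding quantile_def using x by (intro cInf_eq_minimum) auto
  then show ?thesis using T[of x] x y by simp
qed

text \<open>If \<open>quantile F (F x) < x\<close>, then \<open>F\<close> is constant to the left of \<open>x\<close>, so the quantile
  function jumps at \<open>F x\<close>.\<close>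

lemma left_inverse_of_quantile_eq:
  assumes Q: "\<And>y. 0 < y \<Longrightarrow> y < 1 \<Longrightarrow> quantile F y = T y + c"
    and T: "\<And>y. 0 < y \<Longrightarrow> y < 1 \<Longrightarrow> isCont T y"
    and x: "0 < F x" "F x < 1"
  shows "T (F x) = x - c"
proof -
  have "quantile F (F x) \<le> x"
    unfolding quantile_def using bdd_below_superlevel[OF x(1)] by (intro cInf_lower) auto
  moreover have "x \<le> quantile F (F x)"
  proof -
    have lower: "x \<le> quantile F y" if "F x < y" "y < 1" for y
    proof -
      have "0 < y" using that x by linarith
      then obtain z where "F z = y" using attains[OF _ \<open>y < 1\<close>] by auto
      moreover have "x \<le> w" if "y \<le> F w" for w
        using le_if_less[of x w] that \<open>F x < y\<close> by linarith
      ultimately show ?thesis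
        unfolding quantile_def by (intro cInf_greatest) auto
    qed
    \<comment> \<open>Letting \<open>y\<close> decrease to \<open>F x\<close> carries the lower
      bound \<open>x\<close> over to level \<open>F x\<close> itself; continuity of \<open>T\<close>
      excludes a jump.\<close>
    have "((\<lambda>y. T y + c) \<longlongrightarrow> T (F x) + c) (at_right (F x))"
      using T[OF x] by (intro tendsto_intros) (auto simp: isCont_def filterlim_at_split)
    moreover have "\<forall>\<^sub>F y in at_right (F x). x \<le> T y + c"
      unfolding eventually_at_right_field
    proof (intro exI[of _ 1] conjI allI impI)
      fix y assume "F x < y" "y < 1"
      then show "x \<le> T y + c" using lower[of y] Q[of y] x by simp
    qed (rule x)
    ultimately have "x \<le> T (F x) + c"
      by (intro tendsto_lowerbound) auto
    then show ?thesis using Q[OF x] by simp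
  qed
  ultimately show ?thesis using Q[OF x] by simp
qed

text \<open>The last zero of \<open>F\<close> and the first point with value 1, if they exist.
  \<open>F\<close> may have a kink there, as an exponential cdf has at its left end.\<close>

definition support_ends :: "real set" where
  "support_ends = {x. F x = 0 \<and> (\<forall>z>x. 0 < F z)} \<union> {x. F x = 1 \<and> (\<forall>z<x. F z < 1)}"

lemma finite_support_ends: "finite support_ends"
proof -
  have *: "finite S" if "\<And>x z. x \<in> S \<Longrightarrow> z \<in> S \<Longrightarrow> \<not> x < z" for S :: "real set"
  proof (cases "S = {}")
    case False
    then obtain x where "x \<in> S" by auto
    then have "S \<subseteq> {x}" using that by (metis insertCI linorder_neqE subsetI)
    then show ?thesis using finite_subset by blast
  qed simp
  show ?thesis
    unfolding support_ends_def finite_Un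
    by (intro conjI *; simp; metis less_irrefl)
qed

text \<open>A zero of \<open>F\<close> that is not the last one has another zero to its right, and
  monotonicity keeps \<open>F\<close> at 0 up to there; the value 1 is symmetric.\<close>

lemma locally_constant_outside_support:
  assumes "x \<notin> support_ends" "F x = 0 \<or> F x = 1"
  shows "\<forall>\<^sub>F z in nhds x. F z = F x"
  using assms(2)
proof
  assume 0: "F x = 0"
  then have "\<not> (\<forall>z>x. 0 < F z)"
    using assms(1) by (simp add: support_ends_def)
  then obtain z where z: "x < z" "\<not> 0 < F z" by blast
  have "F w = F x" if "w < z" for w
    using monoD[OF mono, of w z] that z 0 range(1)[of w] by linarith
  moreover have "\<forall>\<^sub>F w in nhds x. w \<in> {..<z}"
    using z(1) by (intro eventually_nhds_in_open) auto
  ultimately show ?thesis by (auto elim: eventually_mono)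
next
  assume 1: "F x = 1"
  then have "\<not> (\<forall>z<x. F z < 1)"
    using assms(1) by (simp add: support_ends_def)
  then obtain z where z: "z < x" "\<not> F z < 1" by blast
  have "F w = F x" if "z < w" for w
    using monoD[OF mono, of z w] that z 1 range(2)[of w] by linarith
  moreover have "\<forall>\<^sub>F w in nhds x. w \<in> {z<..}"
    using z(1) by (intro eventually_nhds_in_open) auto
  ultimately show ?thesis by (auto elim: eventually_mono)
qed

end

section \<open>The common cdf as a function of the parent cdf\<close>

locale adjacent_order_stats = continuous_cdf +
  fixes n k :: nat and a b :: real
  assumes k: "1 \<le> k" "k < n"
    and ab: "0 \<le> a" "0 \<le> b" "0 < a + b"
begin

text \<open>\<open>mix\<close> and \<open>gap\<close> are \<open>H\<close> and \<open>H'\<close> as functions of \<open>F\<close>.\<close>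

definition mix :: "real \<Rightarrow> real" where
  "mix u = (b * binomial_tail n k u + a * binomial_tail n (k + 1) u) / (a + b)"

definition gap :: "real \<Rightarrow> real" where
  "gap u = real (n choose k) * u ^ k * (1 - u) ^ (n - k) / (a + b)"

abbreviation T :: "real \<Rightarrow> real" where
  "T \<equiv> log_odds (a * (real n - real k)) (b * real k)"

text \<open>It is the derivative of \<open>T\<close> and also the ratio of the derivative of
  \<open>mix\<close> to \<open>gap\<close>. Because of this double role the equation for
  \<open>F\<close> integrates to \<open>T\<close>.\<close>

definition slope :: "real \<Rightarrow> real" where
  "slope u = b * real k / u + a * (real n - real k) / (1 - u)"

text \<open>The two tails differ by the single binomial term \<open>(a + b) * gap u\<close>, and
  \<open>mix\<close> divides this difference in the ratio of \<open>a\<close> to \<open>b\<close>.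
  These are the two equations for \<open>H\<close>, expressed in the variable
  \<open>u = F x\<close>.\<close>

lemma tail_minus_mix: "binomial_tail n k u - mix u = a * gap u"
  and mix_minus_tail: "mix u - binomial_tail n (k + 1) u = b * gap u"
proof -
  have tail: "binomial_tail n k u = (a + b) * gap u + binomial_tail n (k + 1) u"
    using k ab binomial_tail_Suc[of k n u] by (simp add: gap_def)
  have "mix u = (a + b) * (b * gap u + binomial_tail n (k + 1) u) / (a + b)"
    unfolding mix_def tail by (simp only: algebra_simps)
  then have mix: "mix u = b * gap u + binomial_tail n (k + 1) u"
    using ab by simp
  show "binomial_tail n k u - mix u = a * gap u"
    and "mix u - binomial_tail n (k + 1) u = b * gap u"
    unfolding mix tail by (simp_all add: algebra_simps)
qed

text \<open>Consistent with the zero derivative of \<open>mix (F z)\<close> where \<open>F\<close>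
  is locally constant 0 or 1.\<close>

lemma gap_endpoints: "gap 0 = 0" "gap 1 = 0"
  using k zero_power[of k] zero_power[of "n - k"] by (simp_all add: gap_def)

lemma slope_pos:
  assumes "0 < u" "u < 1"
  shows "0 < slope u"
proof (cases "b = 0")
  case True
  then show ?thesis unfolding slope_def using assms k ab by simp
next
  case False
  then show ?thesis using assms k ab unfolding slope_def
    by (intro add_pos_nonneg) auto
qed

lemma gap_pos: "0 < u \<Longrightarrow> u < 1 \<Longrightarrow> 0 < gap u"
  using k ab by (simp add: gap_def)

lemma DERIV_T:
  assumes "0 < u" "u < 1"
  shows "(T has_real_derivative slope u) (at u)"
  using DERIV_log_odds[OF assms] by (simp add: slope_def)

text \<open>The derivatives of the two tails are the common term
  \<open>(n choose k) * u ^ k * (1 - u) ^ (n - k)\<close> times \<open>k / u\<close> and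
  \<open>(n - k) / (1 - u)\<close> respectively, which gives the two summands of
  \<open>slope\<close>.\<close>

lemma DERIV_mix:
  assumes u: "0 < u" "u < 1"
  shows "(mix has_real_derivative gap u * slope u) (at u)"
proof -
  have "(n - k) * (n choose k) = (k + 1) * (n choose (k + 1))"
    by (metis Suc_eq_plus1 binomial_absorb_comp binomial_absorption)
  then have coeff: "real (k + 1) * real (n choose (k + 1)) = (real n - real k) * real (n choose k)"
    using k by (metis of_nat_diff of_nat_mult order_less_imp_le)
  have "(mix has_real_derivative
      (b * (real k * real (n choose k) * u ^ (k - 1) * (1 - u) ^ (n - k))
       + a * (real (k + 1) * real (n choose (k + 1)) * u ^ (k + 1 - 1) * (1 - u) ^ (n - (k + 1))))
       / (a + b)) (at u)"
    unfolding mix_def using k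
    by (intro DERIV_cdivide DERIV_add DERIV_cmult DERIV_binomial_tail) auto
  moreover have "u ^ k = u * u ^ (k - 1)" "(1 - u) ^ (n - k) = (1 - u) * (1 - u) ^ (n - (k + 1))"
    using k by (simp_all add: Suc_diff_Suc flip: power_Suc)
  moreover have alg: "(b * (real k * C * p * ((1 - u) * q)) + a * ((real n - real k) * C * (u * p) * q)) / (a + b)
      = C * (u * p) * ((1 - u) * q) / (a + b) * (b * real k / u + a * (real n - real k) / (1 - u))"
    for C p q :: real
  proof -
    have "C * (u * p) * ((1 - u) * q) * (b * real k / u) = b * (real k * C * p * ((1 - u) * q))"
      using u by simp
    moreover have "C * (u * p) * ((1 - u) * q) * (a * (real n - real k) / (1 - u))
        = a * ((real n - real k) * C * (u * p) * q)"
      using u by simp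
    ultimately show ?thesis
      by (metis distrib_left times_divide_eq_left)
  qed
  ultimately show ?thesis
    unfolding coeff gap_def slope_def by (simp only: add_diff_cancel_right' alg)
qed

text \<open>Where \<open>F\<close> is strictly between 0 and 1, \<open>mix\<close> has nonzero
  derivative and can be cancelled, leaving \<open>F' = 1 / slope F\<close>. Hence
  \<open>T (F z) - z\<close> has zero derivative, and it is constant because this region is an
  interval.\<close>

lemma log_odds_const_if_DERIV_mix:
  assumes deriv: "\<And>x. ((\<lambda>z. mix (F z)) has_real_derivative gap (F x)) (at x)"
  obtains c where "\<And>x. 0 < F x \<Longrightarrow> F x < 1 \<Longrightarrow> T (F x) = x - c"
proof -
  define S where "S = {x. 0 < F x \<and> F x < 1}"
  have "open S"
    unfolding S_def by (intro open_Collect_conj open_Collect_less continuous_intros cont)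
  have "is_interval S"
    unfolding is_interval_1
  proof (intro allI impI ballI)
    fix v w x assume "v \<in> S" "w \<in> S" "v \<le> x \<and> x \<le> w"
    then show "x \<in> S"
      using monoD[OF mono, of v x] monoD[OF mono, of x w] by (auto simp: S_def)
  qed
  have D: "((\<lambda>z. T (F z) - z) has_real_derivative 0) (at x)" if "x \<in> S" for x
  proof -
    have x: "0 < F x" "F x < 1" using that by (auto simp: S_def)
    have "(F has_real_derivative gap (F x) / (gap (F x) * slope (F x))) (at x)"
      using gap_pos[OF x] slope_pos[OF x]
      by (intro DERIV_cancel_outer[OF DERIV_mix[OF x] _ deriv isCont_F]) auto
    then have dF: "(F has_real_derivative 1 / slope (F x)) (at x)"
      using gap_pos[OF x] by simp
    show ?thesis
      using slope_pos[OF x]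
      by (auto intro!: derivative_eq_intros DERIV_chain2[OF DERIV_T[OF x] dF])
  qed
  then have "continuous_on S (\<lambda>z. T (F z) - z)"
    by (meson DERIV_isCont continuous_at_imp_continuous_on)
  then obtain c where "\<And>x. x \<in> S \<Longrightarrow> T (F x) - x = c"
    using DERIV_zero_connected_constant[of S "{}" "\<lambda>z. T (F z) - z"]
      \<open>open S\<close> \<open>is_interval S\<close> D by (auto simp: is_interval_connected)
  then show thesis by (intro that[of "- c"]) (force simp: S_def)
qed

text \<open>Inside the support \<open>T (F z)\<close> is locally \<open>z - c\<close>; cancelling
  \<open>T\<close> gives \<open>F' = 1 / slope F\<close>, and the chain rule through
  \<open>mix\<close> turns this into \<open>gap\<close>. Elsewhere both sides vanish.\<close>

lemma DERIV_mix_if_log_odds: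
  assumes T: "\<And>x. 0 < F x \<Longrightarrow> F x < 1 \<Longrightarrow> T (F x) = x - c"
    and x: "x \<notin> support_ends"
  shows "((\<lambda>z. mix (F z)) has_real_derivative gap (F x)) (at x)"
proof (cases "0 < F x \<and> F x < 1")
  case True
  then have Fx: "0 < F x" "F x < 1" by auto
  have "open {x. 0 < F x \<and> F x < 1}"
    by (intro open_Collect_conj open_Collect_less continuous_intros cont)
  then have "\<forall>\<^sub>F z in nhds x. z \<in> {x. 0 < F x \<and> F x < 1}"
    using Fx by (intro eventually_nhds_in_open) auto
  then have ev: "\<forall>\<^sub>F z in nhds x. z - c = T (F z)"
    by (rule eventually_mono) (simp add: T)
  have "((\<lambda>z. z - c) has_real_derivative 1) (at x)"
    by (auto intro!: derivative_eq_intros)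
  then have "((\<lambda>z. T (F z)) has_real_derivative 1) (at x)"
    using DERIV_cong_ev[OF refl ev refl] by blast
  then have "(F has_real_derivative 1 / slope (F x)) (at x)"
    using slope_pos[OF Fx] by (intro DERIV_cancel_outer[OF DERIV_T[OF Fx] _ _ isCont_F]) auto
  from DERIV_chain2[OF DERIV_mix[OF Fx] this] show ?thesis
    using slope_pos[OF Fx] by simp
next
  case False
  then have ends: "F x = 0 \<or> F x = 1" using range[of x] by linarith
  then have ev: "\<forall>\<^sub>F z in nhds x. mix (F x) = mix (F z)"
    using locally_constant_outside_support[OF x] by (auto elim: eventually_mono)
  have "((\<lambda>_. mix (F x)) has_real_derivative 0) (at x)" by simp
  then have "((\<lambda>z. mix (F z)) has_real_derivative 0) (at x)"
    using DERIV_cong_ev[OF refl ev refl] by blast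
  then show ?thesis using ends gap_endpoints by auto
qed

end

section \<open>From equality of the mixtures to the quantile function and back\<close>

context adjacent_order_stats
begin

lemma continuous_on_tail: "continuous_on UNIV (\<lambda>x. binomial_tail n j (F x))"
  by (rule continuous_on_compose2[OF continuous_on_binomial_tail cont]) auto

lemma continuous_on_mix: "continuous_on UNIV (\<lambda>x. mix (F x))"
  unfolding mix_def using ab by (intro continuous_intros continuous_on_tail) auto

lemma bounded_comp_F:
  assumes "continuous_on UNIV f"
  obtains B where "\<And>x. \<bar>f (F x)\<bar> \<le> (B :: real)"
proof -
  have "compact (f ` {0..1})"
    by (intro compact_continuous_image continuous_on_subset[OF assms]) auto
  then obtain B where "\<forall>v \<in> f ` {0..1}. norm v \<le> B"
    using compact_imp_bounded bounded_iff by metis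
  then show thesis
    using range by (intro that[of B]) auto
qed

lemma exp_mixture_eq_imp_DERIV:
  assumes eq: "exp_mixture a (\<lambda>x. binomial_tail n k (F x))
    = exp_mixture (- b) (\<lambda>x. binomial_tail n (k + 1) (F x))"
  shows "((\<lambda>z. mix (F z)) has_real_derivative gap (F x)) (at x)"
proof -
  define W where "W = exp_mixture a (\<lambda>x. binomial_tail n k (F x))"
  obtain B1 where B1: "\<bar>binomial_tail n k (F x)\<bar> \<le> B1" for x
    using bounded_comp_F[OF continuous_on_binomial_tail] by blast
  obtain B2 where B2: "\<bar>binomial_tail n (k + 1) (F x)\<bar> \<le> B2" for x
    using bounded_comp_F[OF continuous_on_binomial_tail] by blast
  have W1: "(W has_real_derivative (binomial_tail n k (F x) - W x) / a) (at x)" if "a \<noteq> 0" for x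
    unfolding W_def using that by (intro DERIV_exp_mixture[OF continuous_on_tail B1])
  have W2: "(W has_real_derivative (W x - binomial_tail n (k + 1) (F x)) / b) (at x)" if "b \<noteq> 0" for x
    using DERIV_exp_mixture[OF continuous_on_tail B2, of "- b" x] that
    unfolding W_def eq by (simp add: minus_divide_left)
  have W01: "W x = binomial_tail n k (F x)" if "a = 0" for x
    unfolding W_def that by (rule exp_mixture_0)
  have W02: "W x = binomial_tail n (k + 1) (F x)" if "b = 0" for x
    unfolding W_def eq that minus_zero by (rule exp_mixture_0)
  \<comment> \<open>The equations are stated without division so that they survive
    \<open>a = 0\<close> or \<open>b = 0\<close>. In such a case one of them is the algebraic
    identity of \<open>W\<close> with a tail, and the other one supplies the derivative.\<close>
  have deriv: "\<exists>h. (W has_real_derivative h) (at x) \<and> a * h = binomial_tail n k (F x) - W x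
      \<and> b * h = W x - binomial_tail n (k + 1) (F x)" for x
  proof (cases "a = 0")
    case True
    then have "b \<noteq> 0" using ab by simp
    then show ?thesis
      using True W2[of x] W01[of x] by (intro exI conjI) auto
  next
    case False
    show ?thesis
    proof (cases "b = 0")
      case True
      then show ?thesis
        using False W1[of x] W02[of x] by (intro exI conjI) auto
    next
      case b: False
      have slopes_eq: "(binomial_tail n k (F x) - W x) / a = (W x - binomial_tail n (k + 1) (F x)) / b"
        using W1[OF False] W2[OF b] by (rule DERIV_unique)
      show ?thesis
      proof (intro exI conjI)
        show "(W has_real_derivative (binomial_tail n k (F x) - W x) / a) (at x)"
          by (rule W1[OF False])
        show "a * ((binomial_tail n k (F x) - W x) / a) = binomial_tail n k (F x) - W x"
          using False by simp
        show "b * ((binomial_tail n k (F x) - W x) / a) = W x - binomial_tail n (k + 1) (F x)"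
          unfolding slopes_eq using b by simp
      qed
    qed
  qed
  have "W x = mix (F x) \<and> (W has_real_derivative gap (F x)) (at x)" for x
  proof -
    obtain h where h: "(W has_real_derivative h) (at x)" "a * h = binomial_tail n k (F x) - W x"
      "b * h = W x - binomial_tail n (k + 1) (F x)"
      using deriv by blast
    \<comment> \<open>Adding the two equations eliminates \<open>W x\<close> and leaves the
      difference of the tails.\<close>
    have "(a + b) * h = (a + b) * gap (F x)"
      using h(2,3) tail_minus_mix[of "F x"] mix_minus_tail[of "F x"]
      unfolding distrib_right by linarith
    then have "h = gap (F x)" using ab by simp
    then show ?thesis using h tail_minus_mix[of "F x"] by simp
  qed
  then have "W = (\<lambda>x. mix (F x))" "(W has_real_derivative gap (F x)) (at x)" by auto
  then show ?thesis by simp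
qed

text \<open>The function \<open>mix (F x)\<close> is bounded, continuous and solves the equation of
  the mixture off \<open>support_ends\<close>, so uniqueness applies. The instances are
  \<open>s = a\<close> with \<open>j = k\<close>, and \<open>s = - b\<close> with
  \<open>j = k + 1\<close>.\<close>

lemma exp_mixture_tail_eq_mix:
  assumes T: "\<And>x. 0 < F x \<Longrightarrow> F x < 1 \<Longrightarrow> T (F x) = x - c"
    and s: "\<And>u. binomial_tail n j u - mix u = s * gap u"
  shows "exp_mixture s (\<lambda>x. binomial_tail n j (F x)) = (\<lambda>x. mix (F x))"
proof (cases "s = 0")
  case True
  then show ?thesis using s exp_mixture_0 by (auto simp: fun_eq_iff)
next
  case False
  obtain B where B: "\<bar>binomial_tail n j (F x)\<bar> \<le> B" for x
    using bounded_comp_F[OF continuous_on_binomial_tail] by blast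
  have "continuous_on UNIV mix"
    unfolding mix_def using ab by (intro continuous_intros continuous_on_binomial_tail) auto
  then obtain C where C: "\<bar>mix (F x)\<bar> \<le> C" for x
    using bounded_comp_F by blast
  show ?thesis
  proof (rule exp_mixture_unique[OF continuous_on_tail B continuous_on_mix C False finite_support_ends])
    fix x assume "x \<notin> support_ends"
    then show "((\<lambda>z. mix (F z)) has_real_derivative
        (binomial_tail n j (F x) - mix (F x)) / s) (at x)"
      using DERIV_mix_if_log_odds[OF T] s[of "F x"] False by simp
  qed
qed

lemma exp_mixture_eq_iff_quantile:
  "exp_mixture a (\<lambda>x. binomial_tail n k (F x))
     = exp_mixture (- b) (\<lambda>x. binomial_tail n (k + 1) (F x))
   \<longleftrightarrow> (\<exists>c. \<forall>y. 0 < y \<and> y < 1 \<longrightarrow> quantile F y = T y + c)" (is "?eq \<longleftrightarrow> ?Q")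
proof
  assume ?eq
  show ?Q
  proof (rule log_odds_const_if_DERIV_mix[OF exp_mixture_eq_imp_DERIV[OF \<open>?eq\<close>]])
    fix c assume "\<And>x. 0 < F x \<Longrightarrow> F x < 1 \<Longrightarrow> T (F x) = x - c"
    then show ?Q using quantile_eq_of_left_inverse[of T c] by blast
  qed
next
  assume ?Q
  then obtain c where c: "\<And>y. 0 < y \<Longrightarrow> y < 1 \<Longrightarrow> quantile F y = T y + c" by blast
  have T: "T (F x) = x - c" if "0 < F x" "F x < 1" for x
    using left_inverse_of_quantile_eq[of T c, OF c DERIV_isCont[OF DERIV_T]] that by blast
  have "binomial_tail n (k + 1) u - mix u = - b * gap u" for u
    using mix_minus_tail[of u] by simp
  then show ?eq
    using exp_mixture_tail_eq_mix[OF T tail_minus_mix] exp_mixture_tail_eq_mix[OF T] by simp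
qed

end

section \<open>From equality in distribution to equality of cdfs\<close>

theorem theorem1:
  fixes n k :: nat and a b :: real
    and N :: "'p measure" and X :: "'p \<Rightarrow> real" and F :: "real \<Rightarrow> real"
    and M :: "'w measure" and Xs :: "nat \<Rightarrow> 'w \<Rightarrow> real"
    and \<xi>\<^sub>1 \<xi>\<^sub>2 :: "'w \<Rightarrow> real"
  assumes "1 \<le> k" and "k \<le> n - 1"
    and "a \<ge> 0" and "b \<ge> 0" and "(a, b) \<noteq> (0, 0)"
    and "prob_space N" and "X \<in> borel_measurable N"
    and "F = cdf (distr N borel X)" and "continuous_on UNIV F"
    and "prob_space M"
    and "prob_space.indep_vars M (\<lambda>_. borel) Xs {..<n}"
    and "\<And>i. i < n \<Longrightarrow> distr M borel (Xs i) = distr N borel X"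
    and "distributed M lborel \<xi>\<^sub>1 (exponential_density 1)"
    and "distributed M lborel \<xi>\<^sub>2 (exponential_density 1)"
    and "prob_space.indep_var M borel \<xi>\<^sub>1 borel \<xi>\<^sub>2"
    and "prob_space.indep_var M borel \<xi>\<^sub>1 borel (order_stat n Xs k)"
    and "prob_space.indep_var M borel \<xi>\<^sub>2 borel (order_stat n Xs (k + 1))"
  shows "distr M borel (\<lambda>\<omega>. order_stat n Xs k \<omega> + a * \<xi>\<^sub>1 \<omega>)
           = distr M borel (\<lambda>\<omega>. order_stat n Xs (k + 1) \<omega> - b * \<xi>\<^sub>2 \<omega>)
         \<longleftrightarrow> (\<exists>c>0. \<forall>x. 0 < x \<and> x < 1 \<longrightarrow>
               quantile F x =
                 ln (c * x powr (b * real k) * (1 - x) powr (- a * (real n - real k))))"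
proof -
  interpret N: prob_space N by fact
  interpret M: prob_space M by fact
  interpret D: real_distribution "distr N borel X" using assms(7) by simp
  note F = \<open>F = cdf (distr N borel X)\<close>
  interpret continuous_cdf F
  proof
    show "mono F" unfolding F by (intro monoI D.cdf_nondecreasing)
    show "0 \<le> F x" "F x \<le> 1" for x
      unfolding F by (rule D.cdf_nonneg, rule D.cdf_bounded_prob)
    show "\<exists>x. F x = y" if "0 < y" "y < 1" for y
    proof -
      have "\<forall>\<^sub>F x in at_bot. F x < y"
        unfolding F by (rule order_tendstoD(2)[OF D.cdf_lim_at_bot that(1)])
      then obtain l where l: "F l < y"
        using eventually_happens by (metis trivial_limit_at_bot_linorder)
      have "\<forall>\<^sub>F x in at_top. y < F x"
        unfolding F by (rule order_tendstoD(1)[OF D.cdf_lim_at_top_prob that(2)])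
      then obtain u where u: "y < F u"
        using eventually_happens by (metis trivial_limit_at_top_linorder)
      have "l \<le> u"
        using l u monoD[OF \<open>mono F\<close>, of u l] by linarith
      then show ?thesis
        using IVT'[of F l y u] l u continuous_on_subset[OF assms(9)] by fastforce
    qed
  qed (fact assms(9))
  interpret adjacent_order_stats F n k a b
    using assms(1-5) by unfold_locales auto
  have cdf_stat: "M.prob {\<omega> \<in> space M. order_stat n Xs j \<omega> \<le> x} = binomial_tail n j (F x)"
    if "1 \<le> j" "j \<le> n" for j x
  proof (rule M.cdf_order_stat[OF assms(11) _ that])
    fix i assume i: "i < n"
    then have "Xs i \<in> borel_measurable M"
      using assms(11) by (auto simp: M.indep_vars_def)
    then have "measure (distr M borel (Xs i)) {..x} = M.prob {\<omega> \<in> space M. Xs i \<omega> \<le> x}"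
      by (subst measure_distr) (auto intro!: arg_cong[where f = M.prob])
    then show "M.prob {\<omega> \<in> space M. Xs i \<omega> \<le> x} = F x"
      unfolding F cdf_def assms(12)[OF i, symmetric] by simp
  qed
  have cdf_sum: "cdf (distr M borel (\<lambda>\<omega>. order_stat n Xs j \<omega> + s * \<xi> \<omega>))
      = exp_mixture s (\<lambda>x. binomial_tail n j (F x))"
    if "M.indep_var borel \<xi> borel (order_stat n Xs j)"
      "distributed M lborel \<xi> (exponential_density 1)" "1 \<le> j" "j \<le> n" for \<xi> s j
    using M.cdf_add_exponential[OF that(1,2), of s] continuous_on_tail
    unfolding cdf_stat[OF that(3,4)] by (intro ext) simp
  have k_le: "1 \<le> k" "k \<le> n" "1 \<le> k + 1" "k + 1 \<le> n" using k by auto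
  let ?L = "distr M borel (\<lambda>\<omega>. order_stat n Xs k \<omega> + a * \<xi>\<^sub>1 \<omega>)"
  \<comment> \<open>Writing the subtraction as addition of a negative multiple lets
    \<open>cdf_sum\<close> cover both sides.\<close>
  let ?R = "distr M borel (\<lambda>\<omega>. order_stat n Xs (k + 1) \<omega> + (- b) * \<xi>\<^sub>2 \<omega>)"
  have [measurable]: "\<xi>\<^sub>1 \<in> borel_measurable M" "\<xi>\<^sub>2 \<in> borel_measurable M"
      "order_stat n Xs k \<in> borel_measurable M" "order_stat n Xs (k + 1) \<in> borel_measurable M"
    using assms(16,17) by (auto dest: M.indep_var_rv1 M.indep_var_rv2)
  have L: "real_distribution ?L" and R: "real_distribution ?R"
    by (rule M.real_distribution_distr, measurable)+
  have "?L = ?R \<longleftrightarrow> cdf ?L = cdf ?R"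
    by (rule iffI[OF arg_cong cdf_unique[OF L R]])
  also have "\<dots> \<longleftrightarrow> (\<exists>c. \<forall>y. 0 < y \<and> y < 1 \<longrightarrow> quantile F y = T y + c)"
    unfolding cdf_sum[OF assms(16,13) k_le(1,2)] cdf_sum[OF assms(17,14) k_le(3,4)]
    by (rule exp_mixture_eq_iff_quantile)
  also have "\<dots> \<longleftrightarrow> (\<exists>c>0. \<forall>x. 0 < x \<and> x < 1 \<longrightarrow> quantile F x =
      ln (c * x powr (b * real k) * (1 - x) powr (- a * (real n - real k))))"
  proof -
    have ln_eq: "ln (c * x powr (b * real k) * (1 - x) powr (- a * (real n - real k))) = T x + ln c"
      if "0 < c" "0 < x" "x < 1" for c x
      using that by (simp add: ln_mult ln_powr log_odds_def)
    show ?thesis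
    proof
      assume "\<exists>c. \<forall>y. 0 < y \<and> y < 1 \<longrightarrow> quantile F y = T y + c"
      then obtain c where "\<forall>y. 0 < y \<and> y < 1 \<longrightarrow> quantile F y = T y + c" ..
      then show "\<exists>c>0. \<forall>x. 0 < x \<and> x < 1 \<longrightarrow> quantile F x =
          ln (c * x powr (b * real k) * (1 - x) powr (- a * (real n - real k)))"
        \<comment> \<open>The additive constant \<open>c\<close> becomes the positive factor
          \<open>exp c\<close> under the logarithm.\<close>
        using ln_eq[of "exp c"] by (intro exI[of _ "exp c"]) simp
    next
      assume "\<exists>c>0. \<forall>x. 0 < x \<and> x < 1 \<longrightarrow> quantile F x =
          ln (c * x powr (b * real k) * (1 - x) powr (- a * (real n - real k)))"
      then show "\<exists>c. \<forall>y. 0 < y \<and> y < 1 \<longrightarrow> quantile F y = T y + c"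
        using ln_eq by metis
    qed
  qed
  finally show ?thesis by simp
qed

end
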